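(* Let $E$ and $F$ be Banach lattices such that $F$ has the DP$^{\star}$ property, and let $T:E\to F$ be an operator. The following are equivalent: (1) $T$ is disjoint weak$^{\star}$ Dunford-Pettis. (2) $T$ carries $\sigma$-uaw-compact subsets of $E$ into limited subsets of $F$.
   Context: "Operator" means bounded linear map. A Banach space $X$ has the Dunford-Pettis$^{\star}$ (DP$^{\star}$) property if $f_n(x_n)\to0$ for every weakly null sequence $(x_n)$ in $X$ and every weak$^{\star}$ null sequence $(f_n)$ in $X'$. An operator $T:E\to Y$ from a Banach lattice $E$ into a Banach space $Y$ is disjoint weak$^{\star}$ Dunford-Pettis if $\lim_{n\to\infty} f_n(Tx_n)=0$ for every norm bounded disjoint sequence $(x_n)$ in $E$ and every weak$^{\star}$ null sequence $(f_n)$ in $Y'$. A sequence $(x_n)$ in a Banach lattice $E$ is uaw-convergent to $x\in E$ if $|x_n-x|\wedge u\to0$ weakly for every $u\in E^+$. A norm bounded subset $A$ of $E$ is called (relatively) $\sigma$-uaw-compact if every sequence in $A$ has a subsequence that is uaw-convergent in $E$. A norm bounded subset $A$ of a Banach space $X$ is limited if every weak$^{\star}$ null sequence $(f_n)$ in $X'$ converges to $0$ uniformly on $A$. *)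

theory Defs
  imports "HOL-Analysis.Analysis" "HOL-Library.Lattice_Algebras"
begin

text \<open>Real Banach lattices. The topological dual of a real normed space \<open>'a\<close> is the type
  \<open>'a \<Rightarrow>\<^sub>L real\<close> of bounded linear functionals.\<close>

class banach_lattice = banach + ordered_real_vector + lattice_ab_group_add_abs +
  assumes norm_mono_abs: "\<bar>x\<bar> \<le> \<bar>y\<bar> \<Longrightarrow> norm x \<le> norm y"

instance real :: banach_lattice
  by standard simp

definition weakly_tendsto :: "(nat \<Rightarrow> 'a::real_normed_vector) \<Rightarrow> 'a \<Rightarrow> bool" where
  "weakly_tendsto x l \<longleftrightarrow>
     (\<forall>f :: 'a \<Rightarrow>\<^sub>L real. (\<lambda>n. blinfun_apply f (x n)) \<longlonglongrightarrow> blinfun_apply f l)"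

definition weak_star_null :: "(nat \<Rightarrow> 'a::real_normed_vector \<Rightarrow>\<^sub>L real) \<Rightarrow> bool" where
  "weak_star_null f \<longleftrightarrow> (\<forall>x. (\<lambda>n. blinfun_apply (f n) x) \<longlonglongrightarrow> 0)"

definition DP_star_property :: "'a::banach itself \<Rightarrow> bool" where
  "DP_star_property _ \<longleftrightarrow>
     (\<forall>(x :: nat \<Rightarrow> 'a) (f :: nat \<Rightarrow> 'a \<Rightarrow>\<^sub>L real).
        weakly_tendsto x 0 \<longrightarrow> weak_star_null f \<longrightarrow> (\<lambda>n. blinfun_apply (f n) (x n)) \<longlonglongrightarrow> 0)"

definition disjoint_sequence :: "(nat \<Rightarrow> 'a::banach_lattice) \<Rightarrow> bool" where
  "disjoint_sequence x \<longleftrightarrow> (\<forall>m n. m \<noteq> n \<longrightarrow> inf \<bar>x m\<bar> \<bar>x n\<bar> = 0)"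

definition disjoint_weak_star_Dunford_Pettis ::
    "('a::banach_lattice \<Rightarrow>\<^sub>L 'b::banach) \<Rightarrow> bool" where
  "disjoint_weak_star_Dunford_Pettis T \<longleftrightarrow>
     (\<forall>(x :: nat \<Rightarrow> 'a) (f :: nat \<Rightarrow> 'b \<Rightarrow>\<^sub>L real).
        bounded (range x) \<longrightarrow> disjoint_sequence x \<longrightarrow> weak_star_null f \<longrightarrow>
        (\<lambda>n. blinfun_apply (f n) (blinfun_apply T (x n))) \<longlonglongrightarrow> 0)"

definition uaw_tendsto :: "(nat \<Rightarrow> 'a::banach_lattice) \<Rightarrow> 'a \<Rightarrow> bool" where
  "uaw_tendsto x l \<longleftrightarrow> (\<forall>u\<ge>0. weakly_tendsto (\<lambda>n. inf \<bar>x n - l\<bar> u) 0)"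

text \<open>Compactness here is relative: the uaw-limit of the subsequence need not belong to the set.\<close>

definition sigma_uaw_compact :: "'a::banach_lattice set \<Rightarrow> bool" where
  "sigma_uaw_compact A \<longleftrightarrow> bounded A \<and>
     (\<forall>x :: nat \<Rightarrow> 'a. (\<forall>n. x n \<in> A) \<longrightarrow>
        (\<exists>l r. strict_mono (r :: nat \<Rightarrow> nat) \<and> uaw_tendsto (x \<circ> r) l))"

definition limited_set :: "'a::banach set \<Rightarrow> bool" where
  "limited_set A \<longleftrightarrow> bounded A \<and>
     (\<forall>f :: nat \<Rightarrow> 'a \<Rightarrow>\<^sub>L real. weak_star_null f \<longrightarrow>
        uniform_limit A (\<lambda>n. blinfun_apply (f n)) (\<lambda>_. 0) sequentially)"

end

theory Submission
  imports Defs
begin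

text \<open>Both directions rest on the modulus estimate \<open>\<bar>f x\<bar> \<le> h x\<close> for \<open>x \<ge> 0\<close>, where \<open>h\<close> is a positive
  functional (Riesz and Kantorovich). For an order bounded disjoint sequence it makes the values
  of \<open>f\<close> absolutely summable, so a bounded disjoint sequence is uaw-null and its range is
  \<open>\<sigma>\<close>-uaw-compact; hence (2) implies (1). Conversely, let \<open>(g\<^sub>n)\<close> be the weak* null sequence
  \<open>f\<^sub>n \<circ> T\<close> and \<open>(y\<^sub>n)\<close> bounded and uaw-null. A disjointification argument in the style of Dodds and
  Fremlin yields, for every \<open>\<epsilon> > 0\<close>, some \<open>u \<ge> 0\<close> with \<open>\<bar>g\<^sub>n ((y\<^sub>n\<^sup>+ - u)\<^sup>+)\<bar> \<le> \<epsilon>\<close> eventually, while the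
  remainder \<open>y\<^sub>n\<^sup>+ \<and> u\<close> is weakly null, so that the DP* property of the codomain takes care of it;
  likewise for \<open>y\<^sub>n\<^sup>-\<close>.\<close>

section \<open>Banach lattices\<close>

lemma norm_mono_nonneg:
  fixes x y :: "'a::banach_lattice"
  assumes "0 \<le> x" "x \<le> y"
  shows "norm x \<le> norm y"
  using assms by (intro norm_mono_abs) (simp add: abs_of_nonneg order_trans[OF assms])

lemma norm_abs_lattice [simp]:
  fixes x :: "'a::banach_lattice"
  shows "norm \<bar>x\<bar> = norm x"
  by (intro antisym norm_mono_abs) simp_all

text \<open>The positive cone is norm closed: the negative part of \<open>l\<close> lies below
  \<open>\<bar>x n - l\<bar>\<close>, whose norm tends to 0.\<close>

lemma LIMSEQ_nonneg_banach_lattice: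
  fixes x :: "nat \<Rightarrow> 'a::banach_lattice"
  assumes "x \<longlonglongrightarrow> l" "\<forall>\<^sub>F n in sequentially. 0 \<le> x n"
  shows "0 \<le> l"
proof -
  have "(\<lambda>n. norm (x n - l)) \<longlonglongrightarrow> 0"
    using assms(1) by (simp add: LIM_zero tendsto_norm_zero)
  moreover have "\<forall>\<^sub>F n in sequentially. norm (sup (- l) 0) \<le> norm (x n - l)"
    using assms(2)
  proof eventually_elim
    case (elim n)
    have "- l \<le> x n - l" using elim by simp
    also have "\<dots> \<le> \<bar>x n - l\<bar>" by (rule abs_ge_self)
    finally have "sup (- l) 0 \<le> \<bar>x n - l\<bar>" by simp
    then show ?case
      using norm_mono_nonneg[of "sup (- l) 0" "\<bar>x n - l\<bar>"] by simp
  qed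
  ultimately have "norm (sup (- l) 0) \<le> 0"
    by (rule tendsto_lowerbound[OF _ _ sequentially_bot])
  then have "sup (- l) 0 = 0" by simp
  then have "- l \<le> 0" by (metis sup_ge1)
  then show ?thesis by simp
qed

text \<open>Cutting \<open>x\<close> at level \<open>u\<close> into excess and truncation. This
  serves as the Riesz decomposition below and later separates the small part of a sequence from its
  weakly null part.\<close>

lemma sup_diff_zero_plus_inf:
  fixes x u :: "'a::lattice_ab_group_add"
  shows "sup (x - u) 0 + inf x u = x"
proof -
  have "sup (x - u) 0 = x + sup (- u) (- x)"
    by (simp add: add_sup_distrib_left)
  also have "\<dots> = x - inf x u"
    by (metis neg_inf_eq_sup sup_commute diff_conv_add_uminus)
  finally show ?thesis by (simp only: diff_add_cancel)
qed

lemma inf_add_le: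
  fixes a b c :: "'a::lattice_ab_group_add"
  assumes "0 \<le> a" "0 \<le> b" "0 \<le> c"
  shows "inf (a + b) c \<le> inf a c + inf b c"
proof -
  \<comment> \<open>Of the four sums, the last three dominate \<open>c\<close>; by distributivity
    the infimum of all four is the product-like right-hand side.\<close>
  have "inf (a + b) c \<le> inf (inf (a + b) (a + c)) (inf (c + b) (c + c))"
    using assms
    by (intro le_infI; intro order_trans[OF inf_le1] order_trans[OF inf_le2];
        simp add: add_increasing add_increasing2)
  also have "\<dots> = inf a c + inf b c"
    by (simp add: add_inf_distrib_left add_inf_distrib_right inf.assoc inf.left_commute)
  finally show ?thesis .
qed

section \<open>Functionals on a Banach lattice\<close>

text \<open>The Riesz-Kantorovich formula for the positive part of \<open>f\<close>: the supremum of
  \<open>f\<close> over \<open>{0..x}\<close> is additive and positively homogeneous on the cone and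
  extends to the whole space by differences.\<close>

lemma positive_majorant:
  fixes f :: "'a::banach_lattice \<Rightarrow>\<^sub>L real"
  obtains h :: "'a \<Rightarrow>\<^sub>L real" where "\<And>x. 0 \<le> x \<Longrightarrow> f x \<le> h x" "\<And>x. 0 \<le> x \<Longrightarrow> 0 \<le> h x"
proof -
  define s where "s x = (SUP z\<in>{0..x}. f z)" for x
  have fb: "f z \<le> norm f * norm x" if "z \<in> {0..x}" for x z
  proof -
    have "f z \<le> norm f * norm z" using norm_blinfun[of f z] by simp
    also have "\<dots> \<le> norm f * norm x"
      using that by (intro mult_left_mono norm_mono_nonneg) auto
    finally show ?thesis .
  qed
  have bdd: "bdd_above (f ` {0..x})" for x
    using fb by (intro bdd_aboveI2)
  have s_ge: "f z \<le> s x" if "0 \<le> z" "z \<le> x" for x z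
    unfolding s_def using that by (intro cSUP_upper bdd) auto
  have s_le: "s x \<le> b" if "0 \<le> x" "\<And>z. 0 \<le> z \<Longrightarrow> z \<le> x \<Longrightarrow> f z \<le> b" for x b
    unfolding s_def using that by (intro cSUP_least) auto
  have s_nonneg: "0 \<le> s x" if "0 \<le> x" for x
    using s_ge[of 0 x] that by (simp add: blinfun.zero_right)
  have s_norm: "s x \<le> norm f * norm x" if "0 \<le> x" for x
    using fb that by (intro s_le) auto
  have s_add: "s (x + y) = s x + s y" if xy: "0 \<le> x" "0 \<le> y" for x y
  proof (rule antisym)
    show "s (x + y) \<le> s x + s y"
    proof (rule s_le)
      fix z assume z: "0 \<le> z" "z \<le> x + y"
      \<comment> \<open>Riesz decomposition: the excess of \<open>z\<close> over \<open>x\<close>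
        lies in \<open>{0..y}\<close> and the truncation in \<open>{0..x}\<close>.\<close>
      have "f (sup (z - x) 0) \<le> s y"
        using z xy by (intro s_ge) (auto simp: algebra_simps)
      moreover have "f (inf z x) \<le> s x"
        using z xy by (intro s_ge) auto
      moreover have "f z = f (sup (z - x) 0) + f (inf z x)"
        by (simp flip: blinfun.add_right add: sup_diff_zero_plus_inf)
      ultimately show "f z \<le> s x + s y" by simp
    qed (use xy in simp)
    have "s x \<le> s (x + y) - s y"
    proof (rule s_le)
      fix z assume z: "0 \<le> z" "z \<le> x"
      have "s y \<le> s (x + y) - f z"
      proof (rule s_le)
        fix w assume w: "0 \<le> w" "w \<le> y"
        have "f (z + w) \<le> s (x + y)"
          using z w by (intro s_ge add_mono add_nonneg_nonneg)
        then show "f w \<le> s (x + y) - f z" by (simp add: blinfun.add_right)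
      qed (use xy in simp)
      then show "f z \<le> s (x + y) - s y" by simp
    qed (use xy in simp)
    then show "s x + s y \<le> s (x + y)" by simp
  qed
  have s_scale_le: "s (c *\<^sub>R x) \<le> c * s x" if "0 < c" "0 \<le> x" for c x
  proof (rule s_le)
    fix z assume z: "0 \<le> z" "z \<le> c *\<^sub>R x"
    have "inverse c *\<^sub>R z \<le> inverse c *\<^sub>R (c *\<^sub>R x)"
      using z that by (intro scaleR_left_mono) auto
    then have "f (inverse c *\<^sub>R z) \<le> s x"
      using z that by (intro s_ge) (auto intro!: scaleR_nonneg_nonneg)
    then show "f z \<le> c * s x"
      using that by (simp add: blinfun.scaleR_right field_simps)
  qed (use that in \<open>simp add: scaleR_nonneg_nonneg\<close>)
  have s_zero: "s 0 = 0"
    using s_add[of 0 0] by simp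
  have s_scale: "s (c *\<^sub>R x) = c * s x" if "0 \<le> c" "0 \<le> x" for c x
  proof (cases "c = 0")
    case False
    then have c: "0 < c" using that by simp
    \<comment> \<open>The reverse inequality is \<open>s_scale_le\<close> for the scalar
      \<open>inverse c\<close> at the point \<open>c *\<^sub>R x\<close>.\<close>
    have "s (inverse c *\<^sub>R (c *\<^sub>R x)) \<le> inverse c * s (c *\<^sub>R x)"
      using c that by (intro s_scale_le scaleR_nonneg_nonneg) auto
    then have "c * s x \<le> s (c *\<^sub>R x)"
      using c by (simp add: field_simps)
    then show ?thesis using s_scale_le[OF c \<open>0 \<le> x\<close>] by simp
  qed (simp add: s_zero)
  define H where "H x = s (sup x 0) - s (sup (- x) 0)" for x
  have parts: "sup x 0 - sup (- x) 0 = x" for x :: 'a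
    using sup_diff_zero_plus_inf[of x 0] by (simp add: neg_inf_eq_sup[of x 0, symmetric] minus_equation_iff)
  \<comment> \<open>Additivity of \<open>s\<close> makes the value independent of how
    \<open>x\<close> is written as a difference of positive elements, so linearity of
    \<open>H\<close> can be checked on convenient representations.\<close>
  have H_diff: "H x = s a - s b" if "x = a - b" "0 \<le> a" "0 \<le> b" for x a b
  proof -
    have "sup x 0 - sup (- x) 0 = a - b"
      by (simp only: parts that(1))
    then have "sup x 0 + b = a + sup (- x) 0"
      by (simp only: diff_eq_eq diff_add_eq eq_diff_eq)
    then have "s (sup x 0) + s b = s a + s (sup (- x) 0)"
      using that by (metis s_add sup_ge2)
    then show ?thesis by (simp add: H_def)
  qed
  have "bounded_linear H"
  proof (rule bounded_linear_intro)
    fix x y :: 'a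
    have "H (x + y) = s (sup x 0 + sup y 0) - s (sup (- x) 0 + sup (- y) 0)"
      by (rule H_diff) (simp_all only: add_diff_add parts, simp_all add: add_nonneg_nonneg)
    then show "H (x + y) = H x + H y"
      by (simp add: s_add H_def)
  next
    fix c :: real and x :: 'a
    show "H (c *\<^sub>R x) = c *\<^sub>R H x"
    proof (cases "0 \<le> c")
      case True
      have "H (c *\<^sub>R x) = s (c *\<^sub>R sup x 0) - s (c *\<^sub>R sup (- x) 0)"
        by (rule H_diff)
          (simp_all only: scaleR_diff_right[symmetric] parts, simp_all add: True scaleR_nonneg_nonneg)
      then show ?thesis using True by (simp add: s_scale H_def algebra_simps)
    next
      case False
      \<comment> \<open>A negative scalar exchanges the roles of the positive and the negative
        part.\<close>
      have "H (c *\<^sub>R x) = s ((- c) *\<^sub>R sup (- x) 0) - s ((- c) *\<^sub>R sup x 0)"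
      proof (rule H_diff)
        have "c *\<^sub>R x = c *\<^sub>R (sup x 0 - sup (- x) 0)" by (simp only: parts)
        also have "\<dots> = (- c) *\<^sub>R sup (- x) 0 - (- c) *\<^sub>R sup x 0"
          by (simp only: scaleR_diff_right scaleR_minus_left minus_diff_minus minus_diff_eq)
        finally show "c *\<^sub>R x = (- c) *\<^sub>R sup (- x) 0 - (- c) *\<^sub>R sup x 0" .
        show "0 \<le> (- c) *\<^sub>R sup (- x) 0" "0 \<le> (- c) *\<^sub>R sup x 0"
          using False by (intro scaleR_nonneg_nonneg; simp)+
      qed
      moreover have "s ((- c) *\<^sub>R sup (- x) 0) = (- c) * s (sup (- x) 0)"
        "s ((- c) *\<^sub>R sup x 0) = (- c) * s (sup x 0)"
        using False by (intro s_scale; simp)+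
      ultimately show ?thesis by (simp add: H_def algebra_simps)
    qed
  next
    fix x :: 'a
    have "sup x 0 \<le> \<bar>x\<bar>" "sup (- x) 0 \<le> \<bar>x\<bar>"
      by (simp_all add: abs_ge_self abs_ge_minus_self)
    then have n: "norm (sup x 0) \<le> norm x" "norm (sup (- x) 0) \<le> norm x"
      using norm_mono_nonneg[of _ "\<bar>x\<bar>"] by auto
    have "s (sup x 0) \<le> norm f * norm x" "s (sup (- x) 0) \<le> norm f * norm x"
      by (rule order_trans[OF s_norm], simp, intro mult_left_mono n, simp)+
    \<comment> \<open>Both values of \<open>s\<close> are nonnegative, so their difference is
      bounded by the larger one and no factor 2 appears.\<close>
    then show "norm (H x) \<le> norm x * norm f"
      using s_nonneg[of "sup x 0"] s_nonneg[of "sup (- x) 0"]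
      by (simp add: H_def abs_le_iff mult.commute)
  qed
  then have app: "blinfun_apply (Blinfun H) = H"
    by (rule bounded_linear_Blinfun_apply)
  have H_pos: "H x = s x" if "0 \<le> x" for x
    using H_diff[of x x 0] that by (simp add: s_zero)
  show thesis
    by (rule that[of "Blinfun H"]) (simp_all add: app H_pos s_ge s_nonneg)
qed

lemma abs_positive_majorant:
  fixes f :: "'a::banach_lattice \<Rightarrow>\<^sub>L real"
  obtains h :: "'a \<Rightarrow>\<^sub>L real" where "\<And>x. 0 \<le> x \<Longrightarrow> \<bar>f x\<bar> \<le> h x"
proof -
  obtain h1 :: "'a \<Rightarrow>\<^sub>L real" where h1: "\<And>x. 0 \<le> x \<Longrightarrow> f x \<le> h1 x" "\<And>x. 0 \<le> x \<Longrightarrow> 0 \<le> h1 x"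
    using positive_majorant[of f] by blast
  obtain h2 :: "'a \<Rightarrow>\<^sub>L real" where h2: "\<And>x. 0 \<le> x \<Longrightarrow> (- f) x \<le> h2 x" "\<And>x. 0 \<le> x \<Longrightarrow> 0 \<le> h2 x"
    using positive_majorant[of "- f"] by blast
  show thesis
  proof (rule that[of "h1 + h2"])
    fix x :: 'a assume "0 \<le> x"
    from h1[OF this] h2[OF this] show "\<bar>f x\<bar> \<le> (h1 + h2) x"
      by (simp add: blinfun.add_left blinfun.minus_left)
  qed
qed

text \<open>A signed functional does not respect the order, so domination is carried out for
  \<open>h\<close>, which is monotone because it is nonnegative on the cone.\<close>

lemma weakly_null_dominated:
  fixes v w :: "nat \<Rightarrow> 'a::banach_lattice"
  assumes "weakly_tendsto v 0" "\<And>n. 0 \<le> w n" "\<And>n. w n \<le> v n"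
  shows "weakly_tendsto w 0"
  unfolding weakly_tendsto_def
proof
  fix f :: "'a \<Rightarrow>\<^sub>L real"
  obtain h :: "'a \<Rightarrow>\<^sub>L real" where h: "\<And>x. 0 \<le> x \<Longrightarrow> \<bar>f x\<bar> \<le> h x"
    using abs_positive_majorant[of f] by blast
  have "norm (f (w n)) \<le> h (v n)" for n
  proof -
    have "0 \<le> \<bar>f (v n - w n)\<bar>" by simp
    also have "\<dots> \<le> h (v n - w n)" using assms(3) by (intro h) simp
    finally have "h (w n) \<le> h (v n)" by (simp add: blinfun.diff_right)
    then show ?thesis using h[OF assms(2)[of n]] by simp
  qed
  moreover have "(\<lambda>n. h (v n)) \<longlonglongrightarrow> 0"
    using assms(1) by (simp add: weakly_tendsto_def blinfun.zero_right)
  ultimately have "(\<lambda>n. f (w n)) \<longlonglongrightarrow> 0"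
    by (rule Lim_null_comparison[OF always_eventually[OF allI]])
  then show "(\<lambda>n. f (w n)) \<longlonglongrightarrow> f 0" by (simp add: blinfun.zero_right)
qed

section \<open>Weak convergence under operators, and norm boundedness of weak* null
  sequences\<close>

lemma weakly_tendsto_blinfun_apply:
  fixes T :: "'a::real_normed_vector \<Rightarrow>\<^sub>L 'b::real_normed_vector"
  assumes "weakly_tendsto x l"
  shows "weakly_tendsto (\<lambda>n. T (x n)) (T l)"
  unfolding weakly_tendsto_def
proof
  fix f :: "'b \<Rightarrow>\<^sub>L real"
  have "(\<lambda>n. (f o\<^sub>L T) (x n)) \<longlonglongrightarrow> (f o\<^sub>L T) l"
    using assms unfolding weakly_tendsto_def by blast
  then show "(\<lambda>n. f (T (x n))) \<longlonglongrightarrow> f (T l)" by simp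
qed

text \<open>Banach-Steinhaus by Baire category: the closed sets \<open>K k\<close> cover the space,
  so one of them contains a ball.\<close>

lemma uniform_boundedness:
  fixes f :: "'i \<Rightarrow> 'a::banach \<Rightarrow>\<^sub>L 'b::real_normed_vector"
  assumes "\<And>x. bounded (range (\<lambda>i. f i x))"
  shows "bounded (range f)"
proof -
  define K where "K k = {x. \<forall>i. norm (f i x) \<le> real k}" for k
  have closed_K: "closed (K k)" for k
  proof -
    have "K k = (\<Inter>i. {x. norm (f i x) \<le> real k})" by (auto simp: K_def)
    also have "closed \<dots>" by (intro closed_INT ballI closed_Collect_le continuous_intros)
    finally show ?thesis .
  qed
  have "(\<Union>k. K k) = UNIV"
  proof safe
    fix x
    obtain B where "\<And>i. norm (f i x) \<le> B" using assms[of x] by (auto simp: bounded_iff)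
    moreover obtain k where "B \<le> real k" using real_arch_simple by blast
    ultimately show "x \<in> (\<Union>k. K k)" by (auto simp: K_def intro: order_trans)
  qed simp
  moreover have "interior (\<Union>k. K k) = {}" if "\<And>k. interior (K k) = {}"
    using Met_TC.metric_Baire_category_alt[of "range K"] that closed_K
    by (auto simp: complete_UNIV)
  ultimately obtain k a where "a \<in> interior (K k)" by force
  then obtain r where r: "0 < r" "ball a r \<subseteq> K k" by (auto simp: mem_interior)
  \<comment> \<open>Moving the ball from \<open>a\<close> to the origin writes \<open>z\<close> as a
    difference of two points of \<open>K k\<close>, which doubles the bound.\<close>
  have bound: "norm (f i z) \<le> 2 * real k" if "norm z < r" for i z
  proof -
    have "a \<in> K k" "a + z \<in> K k" using r that by (auto intro!: subsetD[OF r(2)] simp: dist_norm)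
    then have "norm (f i a) \<le> real k" "norm (f i (a + z)) \<le> real k" by (auto simp: K_def)
    moreover have "f i z = f i (a + z) - f i a" by (simp add: blinfun.add_right)
    ultimately show ?thesis
      using norm_triangle_ineq4[of "f i (a + z)" "f i a"] by simp
  qed
  have "norm (f i) \<le> 4 * real k / r" for i
  proof (rule norm_blinfun_bound)
    show "0 \<le> 4 * real k / r" using r(1) by simp
    fix x
    show "norm (f i x) \<le> 4 * real k / r * norm x"
    proof (cases "x = 0")
      case False
      \<comment> \<open>Rescaling to norm \<open>r / 2\<close> stays strictly inside the ball; this
        turns \<open>2 * k\<close> into the constant \<open>4 * k / r\<close>.\<close>
      then have "norm (f i ((r / (2 * norm x)) *\<^sub>R x)) \<le> 2 * real k"
        using r(1) by (intro bound) simp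
      then show ?thesis
        using False r(1) by (simp add: blinfun.scaleR_right field_simps)
    qed (simp add: blinfun.zero_right)
  qed
  then show ?thesis by (auto intro!: boundedI)
qed

lemma weak_star_null_bounded:
  fixes f :: "nat \<Rightarrow> 'a::banach \<Rightarrow>\<^sub>L real"
  assumes "weak_star_null f"
  obtains C where "\<And>n. norm (f n) \<le> C"
proof -
  have "bounded (range (\<lambda>n. f n x))" for x
    using assms convergent_imp_bounded unfolding weak_star_null_def by blast
  then have "bounded (range f)" by (rule uniform_boundedness)
  then show thesis using that by (auto simp: bounded_iff)
qed

lemma weak_star_null_subseq:
  assumes "weak_star_null f" "strict_mono r"
  shows "weak_star_null (f \<circ> r)"
  using assms unfolding weak_star_null_def
  by (auto intro: LIMSEQ_subseq_LIMSEQ[unfolded o_def])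

section \<open>Disjoint sequences\<close>

text \<open>For disjoint positive elements sums are suprema, since a sum of two elements is their
  infimum plus their supremum. The auxiliary fact keeps each partial sum disjoint from all later
  terms.\<close>

lemma sum_disjoint_le:
  fixes y :: "nat \<Rightarrow> 'a::lattice_ab_group_add"
  assumes nonneg: "\<And>n. 0 \<le> y n" and le: "\<And>n. y n \<le> u"
    and disj: "\<And>m n. m \<noteq> n \<Longrightarrow> inf (y m) (y n) = 0"
  shows "sum y {..<n} \<le> u"
proof -
  have *: "inf (sum y {..<n}) (y m) = 0" if "n \<le> m" for n m
    using that
  proof (induction n)
    case 0
    then show ?case using nonneg by (simp add: inf_absorb1)
  next
    case (Suc n)
    have "inf (sum y {..<Suc n}) (y m) \<le> inf (sum y {..<n}) (y m) + inf (y n) (y m)"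
      unfolding sum.lessThan_Suc by (intro inf_add_le sum_nonneg nonneg)
    also have "\<dots> = 0" using Suc disj by simp
    finally show ?case
      using nonneg by (intro antisym le_infI sum_nonneg) auto
  qed
  show ?thesis
  proof (induction n)
    case 0
    show ?case using order_trans[OF nonneg le] by simp
  next
    case (Suc n)
    have "sum y {..<Suc n} = sup (sum y {..<n}) (y n)"
      using add_eq_inf_sup[of "sum y {..<n}" "y n"] *[OF order_refl, of n] by simp
    then show ?case using Suc le by simp
  qed
qed

text \<open>The truncations at \<open>u\<close> are again disjoint and lie below \<open>u\<close>,
  so all partial sums of \<open>h (y n)\<close> stay below \<open>h u\<close> and the terms tend to
  0.\<close>

lemma disjoint_sequence_uaw_null:
  fixes x :: "nat \<Rightarrow> 'a::banach_lattice"
  assumes "disjoint_sequence x"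
  shows "uaw_tendsto x 0"
  unfolding uaw_tendsto_def weakly_tendsto_def
proof (intro allI impI)
  fix u :: 'a and f :: "'a \<Rightarrow>\<^sub>L real"
  assume u: "0 \<le> u"
  define y where "y n = inf \<bar>x n\<bar> u" for n
  have y0: "0 \<le> y n" for n using u by (simp add: y_def)
  obtain h :: "'a \<Rightarrow>\<^sub>L real" where h: "\<And>x. 0 \<le> x \<Longrightarrow> \<bar>f x\<bar> \<le> h x"
    using abs_positive_majorant[of f] by blast
  have h0: "0 \<le> h z" if "0 \<le> z" for z using h[OF that] by simp
  have "inf (y m) (y n) = 0" if "m \<noteq> n" for m n
  proof (rule antisym)
    have "inf (y m) (y n) \<le> inf \<bar>x m\<bar> \<bar>x n\<bar>"
      by (auto simp: y_def intro: le_infI1 le_infI2)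
    then show "inf (y m) (y n) \<le> 0"
      using assms that by (metis disjoint_sequence_def)
  qed (use y0 in simp)
  then have sum_le: "sum y {..<n} \<le> u" for n
    using y0 by (intro sum_disjoint_le) (simp_all add: y_def)
  have "summable (\<lambda>n. h (y n))"
  proof (rule summableI_nonneg_bounded)
    fix n
    show "0 \<le> h (y n)" using h0 y0 by simp
    have "0 \<le> h (u - sum y {..<n})" using sum_le by (intro h0) simp
    then show "(\<Sum>i<n. h (y i)) \<le> h u" by (simp add: blinfun.diff_right blinfun.sum_right)
  qed
  then have "(\<lambda>n. h (y n)) \<longlonglongrightarrow> 0" by (rule summable_LIMSEQ_zero)
  moreover have "norm (f (y n)) \<le> h (y n)" for n
    using h[OF y0[of n]] by simp
  ultimately have "(\<lambda>n. f (y n)) \<longlonglongrightarrow> 0"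
    by (rule Lim_null_comparison[OF always_eventually[OF allI], rotated])
  then show "(\<lambda>n. f (inf \<bar>x n - 0\<bar> u)) \<longlonglongrightarrow> f 0"
    by (simp add: y_def blinfun.zero_right)
qed

text \<open>A sequence in the range of \<open>x\<close> may repeat or permute terms; this dichotomy
  on the indices yields a subsequence that is constant or runs forward through
  \<open>x\<close>.\<close>

lemma nat_seq_const_or_strict_mono:
  fixes k :: "nat \<Rightarrow> nat"
  obtains r c where "strict_mono (r :: nat \<Rightarrow> nat)" "\<And>n. k (r n) = c"
  | r where "strict_mono (r :: nat \<Rightarrow> nat)" "strict_mono (k \<circ> r)"
proof (cases "\<exists>c. infinite (k -` {c})")
  case True
  then obtain c where c: "infinite (k -` {c})" by blast
  then show thesis
    using that(1)[of "enumerate (k -` {c})" c] enumerate_in_set[OF c] strict_mono_enumerate[OF c]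
    by auto
next
  case False
  have "\<exists>n>a. k a < k n" for a
  proof -
    \<comment> \<open>If every value is taken only finitely often, only finitely many indices have
      value at most \<open>k a\<close>, so a later index with a larger value exists.\<close>
    have "finite (\<Union>c\<le>k a. k -` {c})" using False by blast
    then have "finite ((\<Union>c\<le>k a. k -` {c}) \<union> {..a})" by simp
    then obtain n where "n \<notin> (\<Union>c\<le>k a. k -` {c}) \<union> {..a}"
      using ex_new_if_finite[OF infinite_UNIV_nat] by blast
    then show ?thesis by (intro exI[of _ n]) (auto simp: not_le)
  qed
  then obtain r where r: "\<And>n::nat. r n < r (Suc n) \<and> k (r n) < k (r (Suc n))"
    using dependent_nat_choice[of "\<lambda>_ _. True" "\<lambda>_ a b. a < b \<and> k a < k b"] by blast
  then show thesis
    by (intro that(2)[of r]) (auto simp: strict_mono_Suc_iff)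
qed

lemma disjoint_sequence_range_sigma_uaw_compact:
  fixes x :: "nat \<Rightarrow> 'a::banach_lattice"
  assumes "bounded (range x)" "disjoint_sequence x"
  shows "sigma_uaw_compact (range x)"
  unfolding sigma_uaw_compact_def
proof (intro conjI allI impI)
  fix z :: "nat \<Rightarrow> 'a"
  assume "\<forall>n. z n \<in> range x"
  then have "\<forall>n. \<exists>k. z n = x k" by auto
  then obtain k where k: "\<And>n. z n = x (k n)" by metis
  show "\<exists>l r. strict_mono (r :: nat \<Rightarrow> nat) \<and> uaw_tendsto (z \<circ> r) l"
  proof (rule nat_seq_const_or_strict_mono[of k])
    fix r :: "nat \<Rightarrow> nat" and c
    assume r: "strict_mono r" "\<And>n. k (r n) = c"
    then have "uaw_tendsto (z \<circ> r) (x c)"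
      by (simp add: uaw_tendsto_def weakly_tendsto_def k inf_absorb1)
    then show ?thesis using r(1) by blast
  next
    fix r :: "nat \<Rightarrow> nat"
    assume r: "strict_mono r" "strict_mono (k \<circ> r)"
    \<comment> \<open>Strict monotonicity makes the indices distinct, hence the terms disjoint; the
      limit is then 0, whereas in the constant case it is \<open>x c\<close>.\<close>
    have "disjoint_sequence (z \<circ> r)"
      using assms(2) strict_mono_eq[OF r(2)] by (auto simp: disjoint_sequence_def k)
    then show ?thesis using r(1) disjoint_sequence_uaw_null by blast
  qed
qed (rule assms)

section \<open>Disjointification of bounded positive sequences\<close>

lemma disjoint_positive_parts:
  fixes a b c d :: "'a::{ordered_real_vector, lattice_ab_group_add}"
  assumes "0 < t" "t \<le> 1" "c \<le> b - inverse t *\<^sub>R a" "d \<le> a - t *\<^sub>R b"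
  shows "inf (sup c 0) (sup d 0) = 0"
proof (rule antisym)
  \<comment> \<open>Here \<open>c \<le> - z\<close> and \<open>d \<le> t *\<^sub>R z\<close>, so
    with \<open>t \<le> 1\<close> the two positive parts lie below the negative and the positive
    part of \<open>z\<close>, which are disjoint.\<close>
  define z where "z = inverse t *\<^sub>R a - b"
  have "d \<le> t *\<^sub>R z"
    using assms by (simp add: z_def scaleR_diff_right)
  also have "\<dots> \<le> t *\<^sub>R sup z 0"
    using assms by (intro scaleR_left_mono) auto
  also have "\<dots> \<le> 1 *\<^sub>R sup z 0"
    using assms by (intro scaleR_right_mono) auto
  finally have "sup d 0 \<le> sup z 0" by simp
  moreover have "sup c 0 \<le> sup (- z) 0"
    using assms(3) by (intro sup_mono) (simp_all add: z_def)
  ultimately have "inf (sup c 0) (sup d 0) \<le> inf (sup (- z) 0) (sup z 0)"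
    by (intro inf_mono)
  also have "\<dots> = 0"
  proof -
    have "sup z 0 = sup (- z) 0 + z"
      by (simp add: add_sup_distrib_right sup_commute)
    then have "inf (sup (- z) 0) (sup z 0) = sup (- z) 0 + inf 0 z"
      by (simp add: add_inf_distrib_left)
    also have "inf 0 z = - sup (- z) 0"
      by (metis inf_eq_neg_sup minus_zero sup_commute)
    finally show ?thesis by (simp only: add.right_inverse)
  qed
  finally show "inf (sup c 0) (sup d 0) \<le> 0" .
qed simp

text \<open>If no \<open>u\<close> worked, large excesses over ever bigger multiples of the earlier
  terms could be chosen; they are almost disjoint, and correcting them contradicts
  \<open>disj\<close>. That hypothesis speaks of \<open>g (r n)\<close> because the disjoint
  sequence is built along chosen indices only.\<close>

lemma disjointification:
  fixes p :: "nat \<Rightarrow> 'a::banach_lattice" and g :: "nat \<Rightarrow> 'a \<Rightarrow>\<^sub>L real"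
  assumes p0: "\<And>n. 0 \<le> p n" and pB: "\<And>n. norm (p n) \<le> B" and gC: "\<And>n. norm (g n) \<le> C"
    and disj: "\<And>v r. strict_mono (r :: nat \<Rightarrow> nat) \<Longrightarrow> bounded (range v) \<Longrightarrow>
      disjoint_sequence v \<Longrightarrow> (\<lambda>n. g (r n) (v n)) \<longlonglongrightarrow> 0"
    and "0 < e"
  shows "\<exists>u\<ge>0. \<forall>\<^sub>F n in sequentially. \<bar>g n (sup (p n - u) 0)\<bar> \<le> e"
proof (rule ccontr)
  assume "\<not> ?thesis"
  then have neg: "\<exists>n>N. e < \<bar>g n (sup (p n - u) 0)\<bar>" if "0 \<le> u" for u N
    using that by (auto simp: eventually_sequentially not_le) (meson Suc_le_eq)
  \<comment> \<open>The state pairs the last chosen index with a running sum of the chosen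
    \<open>p n\<close>; stage \<open>k\<close> applies the negated claim with \<open>u\<close> equal
    to \<open>4 ^ k\<close> times that sum.\<close>
  have "\<exists>nS. \<forall>k. 0 \<le> snd (nS k) \<and>
      (fst (nS k) < fst (nS (Suc k)) \<and> snd (nS (Suc k)) = snd (nS k) + p (fst (nS (Suc k))) \<and>
       e < \<bar>g (fst (nS (Suc k))) (sup (p (fst (nS (Suc k))) - 4 ^ k *\<^sub>R snd (nS k)) 0)\<bar>)"
  proof (rule dependent_nat_choice)
    show "\<exists>nS :: nat \<times> 'a. 0 \<le> snd nS" by (intro exI[of _ "(0, 0)"]) simp
  next
    fix nS :: "nat \<times> 'a" and k :: nat
    assume S: "0 \<le> snd nS"
    obtain n where "fst nS < n" "e < \<bar>g n (sup (p n - 4 ^ k *\<^sub>R snd nS) 0)\<bar>"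
      using neg[of "4 ^ k *\<^sub>R snd nS" "fst nS"] S by (auto simp: scaleR_nonneg_nonneg)
    then show "\<exists>nS'. 0 \<le> snd nS' \<and> fst nS < fst nS' \<and> snd nS' = snd nS + p (fst nS') \<and>
       e < \<bar>g (fst nS') (sup (p (fst nS') - 4 ^ k *\<^sub>R snd nS) 0)\<bar>"
      using S p0 by (intro exI[of _ "(n, snd nS + p n)"]) (simp add: add_nonneg_nonneg)
  qed
  then obtain nS where nS: "\<And>k. 0 \<le> snd (nS k)" "\<And>k. fst (nS k) < fst (nS (Suc k))"
    "\<And>k. snd (nS (Suc k)) = snd (nS k) + p (fst (nS (Suc k)))"
    "\<And>k. e < \<bar>g (fst (nS (Suc k))) (sup (p (fst (nS (Suc k))) - 4 ^ k *\<^sub>R snd (nS k)) 0)\<bar>"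
    by blast
  \<comment> \<open>The shift by \<open>Suc\<close> aligns the indices: \<open>q k\<close> is chosen
    against \<open>S k\<close>, which already accounts for \<open>p (q j)\<close> for all
    \<open>j < k\<close>.\<close>
  define q where "q k = fst (nS (Suc k))" for k
  define S where "S k = snd (nS k)" for k
  have q: "strict_mono q" using nS(2) by (simp add: q_def strict_mono_Suc_iff)
  have S0: "0 \<le> S k" for k using nS(1) by (simp add: S_def)
  have S_Suc: "S (Suc k) = S k + p (q k)" for k using nS(3) by (simp add: S_def q_def)
  have large: "e < \<bar>g (q k) (sup (p (q k) - 4 ^ k *\<^sub>R S k) 0)\<bar>" for k
    using nS(4) by (simp add: S_def q_def)
  have "incseq S" using S_Suc p0 by (simp add: incseq_Suc_iff)
  have S_ge: "p (q j) \<le> S k" if "j < k" for j k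
  proof -
    have "p (q j) \<le> S (Suc j)" using S_Suc S0 by simp
    also have "\<dots> \<le> S k" using \<open>incseq S\<close> that by (simp add: incseq_def)
    finally show ?thesis .
  qed

  \<comment> \<open>The weights make the series of the bounded terms converge in norm; its sum
    \<open>y\<close> is one element that dominates every \<open>t k\<close>.\<close>
  define t where "t i = (1/2) ^ i *\<^sub>R p (q i)" for i
  have t0: "0 \<le> t i" for i by (simp add: t_def p0 scaleR_nonneg_nonneg)
  have "summable t"
  proof (rule summable_comparison_test)
    show "\<exists>N. \<forall>n\<ge>N. norm (t n) \<le> (1/2) ^ n * B"
      by (auto simp: t_def intro!: mult_left_mono pB)
    show "summable (\<lambda>n. (1/2) ^ n * B)" by (intro summable_mult2 summable_geometric) simp
  qed
  define y where "y = suminf t"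
  have t_y: "t k \<le> y" for k
  proof -
    have "(\<lambda>n. sum t {..<n} - t k) \<longlonglongrightarrow> y - t k"
      unfolding y_def using summable_LIMSEQ[OF \<open>summable t\<close>] by (intro tendsto_diff tendsto_const)
    moreover have "\<forall>\<^sub>F n in sequentially. 0 \<le> sum t {..<n} - t k"
      using eventually_gt_at_top[of k]
    proof eventually_elim
      case (elim n)
      have "sum t {..<n} = t k + sum t ({..<n} - {k})"
        using elim by (intro sum.remove) auto
      then show ?case by (simp add: sum_nonneg t0)
    qed
    ultimately have "0 \<le> y - t k" by (rule LIMSEQ_nonneg_banach_lattice)
    then show ?thesis by simp
  qed
  have y0: "0 \<le> y" using t0[of 0] t_y[of 0] by (rule order_trans)

  txt \<open>Since \<open>2\<^sup>-\<^sup>k p (q k) \<le> y\<close>, subtracting \<open>2\<^sup>-\<^sup>k y\<close> makes the elements \<open>w k\<close> disjoint at the cost of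
    a perturbation that is null in norm.\<close>
  define w where "w k = sup (p (q k) - 4 ^ k *\<^sub>R S k) 0" for k
  define v where "v k = sup (p (q k) - 4 ^ k *\<^sub>R S k - (1/2) ^ k *\<^sub>R y) 0" for k
  have v_le: "v k \<le> w k" for k
    unfolding v_def w_def using y0 by (intro sup_mono) (simp_all add: scaleR_nonneg_nonneg)
  have w_le: "w k \<le> v k + (1/2) ^ k *\<^sub>R y" for k
  proof -
    have "p (q k) - 4 ^ k *\<^sub>R S k - (1/2) ^ k *\<^sub>R y \<le> v k" by (simp add: v_def)
    moreover have "0 \<le> v k" by (simp add: v_def)
    ultimately show ?thesis
      using y0 by (simp add: w_def scaleR_nonneg_nonneg add_nonneg_nonneg algebra_simps)
  qed
  \<comment> \<open>\<open>disjoint_positive_parts\<close> is used with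
    \<open>t = (1/4) ^ k\<close>, \<open>a = p (q j)\<close> and \<open>b = p (q k)\<close>. The sum
    \<open>S k\<close> absorbs the earlier term in \<open>v k\<close>, and the multiple of
    \<open>y\<close> absorbs the later term in \<open>v j\<close>.\<close>
  have v_disj: "inf (v k) (v j) = 0" if "j < k" for j k
    unfolding v_def
  proof (rule disjoint_positive_parts)
    show "0 < (1/4 :: real) ^ k" "(1/4 :: real) ^ k \<le> 1" by (simp_all add: power_le_one)
    have "4 ^ k *\<^sub>R p (q j) \<le> 4 ^ k *\<^sub>R S k"
      using S_ge[OF that] by (intro scaleR_left_mono) auto
    also have "\<dots> \<le> 4 ^ k *\<^sub>R S k + (1/2) ^ k *\<^sub>R y"
      using y0 by (simp add: scaleR_nonneg_nonneg)
    finally show "p (q k) - 4 ^ k *\<^sub>R S k - (1/2) ^ k *\<^sub>R y \<le> p (q k) - inverse ((1/4) ^ k) *\<^sub>R p (q j)"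
      by (simp add: power_divide algebra_simps)
    have "(1/4) ^ k *\<^sub>R p (q k) \<le> ((1/2) ^ j * (1/2) ^ k) *\<^sub>R p (q k)"
    proof (intro scaleR_right_mono p0)
      \<comment> \<open>The base 4 pays for two factors: \<open>(1/2) ^ k\<close> turns
        \<open>p (q k)\<close> into \<open>t k\<close>, and \<open>(1/2) ^ j\<close> matches the
        multiple of \<open>y\<close> subtracted in \<open>v j\<close>.\<close>
      have "(1/4 :: real) ^ k = (1/2) ^ (k + k)"
        by (simp add: power_add flip: power_mult_distrib)
      also have "\<dots> \<le> (1/2) ^ (j + k)" using that by (intro power_decreasing) auto
      finally show "(1/4 :: real) ^ k \<le> (1/2) ^ j * (1/2) ^ k" by (simp add: power_add)
    qed
    also have "\<dots> = (1/2) ^ j *\<^sub>R t k" by (simp add: t_def)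
    also have "\<dots> \<le> (1/2) ^ j *\<^sub>R y" using t_y by (intro scaleR_left_mono) auto
    also have "\<dots> \<le> 4 ^ j *\<^sub>R S j + (1/2) ^ j *\<^sub>R y"
      using S0 by (simp add: scaleR_nonneg_nonneg)
    finally show "p (q j) - 4 ^ j *\<^sub>R S j - (1/2) ^ j *\<^sub>R y \<le> p (q j) - (1/4) ^ k *\<^sub>R p (q k)"
      by (simp add: algebra_simps)
  qed
  have v0: "0 \<le> v k" for k by (simp add: v_def)
  have "disjoint_sequence v"
    unfolding disjoint_sequence_def
  proof (intro allI impI)
    fix m n :: nat assume "m \<noteq> n"
    then show "inf \<bar>v m\<bar> \<bar>v n\<bar> = 0"
      using v_disj[of m n] v_disj[of n m] v0 by (cases "m < n") (simp_all add: abs_of_nonneg inf_commute)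
  qed
  moreover have "bounded (range v)"
  proof (rule boundedI)
    fix z assume "z \<in> range v"
    then obtain k where z: "z = v k" by blast
    have "w k \<le> p (q k)" using S0 p0 by (simp add: w_def scaleR_nonneg_nonneg)
    then have "v k \<le> p (q k)" using v_le order_trans by blast
    then show "norm z \<le> B" using norm_mono_nonneg[OF v0] pB order_trans z by blast
  qed
  ultimately have "(\<lambda>k. g (q k) (v k)) \<longlonglongrightarrow> 0" using disj[OF q] by blast
  \<comment> \<open>The correction lies between 0 and \<open>(1/2) ^ k *\<^sub>R y\<close>, so the
    common bound \<open>C\<close> on the functionals makes its contribution vanish.\<close>
  moreover have "(\<lambda>k. g (q k) (w k - v k)) \<longlonglongrightarrow> 0"
  proof (rule Lim_null_comparison)
    show "\<forall>\<^sub>F k in sequentially. norm (g (q k) (w k - v k)) \<le> C * ((1/2) ^ k * norm y)"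
    proof (intro always_eventually allI)
      fix k
      have "norm (w k - v k) \<le> norm ((1/2) ^ k *\<^sub>R y)"
        using v_le w_le by (intro norm_mono_nonneg) (simp_all add: algebra_simps)
      then show "norm (g (q k) (w k - v k)) \<le> C * ((1/2) ^ k * norm y)"
        using gC[of "q k"] order_trans[OF norm_ge_zero gC]
        by (intro order_trans[OF norm_blinfun] mult_mono) auto
    qed
    show "(\<lambda>k. C * ((1/2) ^ k * norm y)) \<longlonglongrightarrow> 0"
      by (intro tendsto_mult_right_zero tendsto_mult_left_zero LIMSEQ_power_zero) simp
  qed
  ultimately have "(\<lambda>k. g (q k) (v k) + g (q k) (w k - v k)) \<longlonglongrightarrow> 0 + 0"
    by (rule tendsto_add)
  then have "(\<lambda>k. g (q k) (w k)) \<longlonglongrightarrow> 0"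
    by (simp flip: blinfun.add_right)
  then have "\<forall>\<^sub>F k in sequentially. \<bar>g (q k) (w k)\<bar> < e"
    using \<open>0 < e\<close> by (auto simp: tendsto_iff)
  then obtain k where "\<bar>g (q k) (w k)\<bar> < e" by (auto simp: eventually_sequentially)
  then show False using large[of k] by (simp add: w_def)
qed

section \<open>The equivalence\<close>

lemma disjoint_weak_star_DP_positive:
  fixes T :: "'e::banach_lattice \<Rightarrow>\<^sub>L 'f::banach"
  assumes DP: "DP_star_property TYPE('f)" and T: "disjoint_weak_star_Dunford_Pettis T"
    and f: "weak_star_null f"
    and p0: "\<And>n. 0 \<le> p n" and pb: "bounded (range p)"
    and pw: "\<And>u. 0 \<le> u \<Longrightarrow> weakly_tendsto (\<lambda>n. inf (p n) u) 0"
  shows "(\<lambda>n. f n (T (p n))) \<longlonglongrightarrow> 0"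
proof (rule tendstoI)
  fix e :: real assume "0 < e"
  obtain B where B: "\<And>n. norm (p n) \<le> B" using pb by (auto simp: bounded_iff)
  \<comment> \<open>Uniform boundedness supplies the common norm bound that
    \<open>disjointification\<close> requires of the functionals
    \<open>f n o\<^sub>L T\<close>.\<close>
  obtain C where C: "\<And>n. norm (f n) \<le> C" using weak_star_null_bounded[OF f] by blast
  have gC: "norm (f n o\<^sub>L T) \<le> C * norm T" for n
    by (rule order_trans[OF norm_blinfun_compose]) (intro mult_right_mono C norm_ge_zero)
  have "\<exists>u\<ge>0. \<forall>\<^sub>F n in sequentially. \<bar>(f n o\<^sub>L T) (sup (p n - u) 0)\<bar> \<le> e / 2"
  proof (rule disjointification[OF p0 B gC])
    fix v :: "nat \<Rightarrow> 'e" and r :: "nat \<Rightarrow> nat"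
    assume "strict_mono r" "bounded (range v)" "disjoint_sequence v"
    then have "(\<lambda>n. (f \<circ> r) n (T (v n))) \<longlonglongrightarrow> 0"
      using T weak_star_null_subseq[OF f, of r]
      unfolding disjoint_weak_star_Dunford_Pettis_def by blast
    then show "(\<lambda>n. (f (r n) o\<^sub>L T) (v n)) \<longlonglongrightarrow> 0" by simp
  qed (use \<open>0 < e\<close> in simp)
  then obtain u where u: "0 \<le> u"
    "\<forall>\<^sub>F n in sequentially. \<bar>f n (T (sup (p n - u) 0))\<bar> \<le> e / 2"
    by auto
  have "weakly_tendsto (\<lambda>n. T (inf (p n) u)) 0"
    using weakly_tendsto_blinfun_apply[OF pw[OF u(1)], of T] by (simp add: blinfun.zero_right)
  then have "(\<lambda>n. f n (T (inf (p n) u))) \<longlonglongrightarrow> 0"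
    using DP f by (simp add: DP_star_property_def)
  then have "\<forall>\<^sub>F n in sequentially. dist (f n (T (inf (p n) u))) 0 < e / 2"
    using half_gt_zero[OF \<open>0 < e\<close>] by (rule tendstoD)
  with u(2) show "\<forall>\<^sub>F n in sequentially. dist (f n (T (p n))) 0 < e"
  proof eventually_elim
    case (elim n)
    have "f n (T (p n)) = f n (T (sup (p n - u) 0)) + f n (T (inf (p n) u))"
      by (simp flip: blinfun.add_right add: sup_diff_zero_plus_inf)
    then show ?case using elim by (simp add: dist_real_def)
  qed
qed

lemma disjoint_weak_star_DP_uaw_null:
  fixes T :: "'e::banach_lattice \<Rightarrow>\<^sub>L 'f::banach"
  assumes DP: "DP_star_property TYPE('f)" and T: "disjoint_weak_star_Dunford_Pettis T"
    and f: "weak_star_null f" and yb: "bounded (range y)" and y: "uaw_tendsto y 0"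
  shows "(\<lambda>n. f n (T (y n))) \<longlonglongrightarrow> 0"
proof -
  have part: "(\<lambda>n. f n (T (p n))) \<longlonglongrightarrow> 0" if p: "\<And>n. 0 \<le> p n" "\<And>n. p n \<le> \<bar>y n\<bar>" for p
  proof (rule disjoint_weak_star_DP_positive[OF DP T f p(1)])
    obtain B where B: "\<And>n. norm (y n) \<le> B" using yb by (auto simp: bounded_iff)
    have "norm (p n) \<le> B" for n
      using norm_mono_nonneg[OF p(1)[of n] p(2)] B[of n] by simp
    then show "bounded (range p)" by (auto intro!: boundedI)
    fix u :: 'e assume "0 \<le> u"
    then have "weakly_tendsto (\<lambda>n. inf \<bar>y n\<bar> u) 0" using y by (simp add: uaw_tendsto_def)
    then show "weakly_tendsto (\<lambda>n. inf (p n) u) 0"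
      by (rule weakly_null_dominated) (use p \<open>0 \<le> u\<close> in \<open>auto intro: le_infI1\<close>)
  qed
  \<comment> \<open>The negative part is written as \<open>sup (y n) 0 - y n\<close>, so that by
    linearity the difference collapses to the value at \<open>y n\<close>.\<close>
  have "(\<lambda>n. f n (T (sup (y n) 0)) - f n (T (sup (y n) 0 - y n))) \<longlonglongrightarrow> 0 - 0"
  proof (intro tendsto_diff part)
    fix n
    have "sup (y n) 0 - y n = sup 0 (- y n)"
      by (simp add: diff_conv_add_uminus add_sup_distrib_right del: add_uminus_conv_diff)
    then show "0 \<le> sup (y n) 0 - y n" "sup (y n) 0 - y n \<le> \<bar>y n\<bar>"
      by (simp_all add: abs_ge_minus_self)
  qed (simp_all add: abs_ge_self)
  then show ?thesis by (simp flip: blinfun.diff_right)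
qed

theorem theorem3p4:
  fixes T :: "'e::banach_lattice \<Rightarrow>\<^sub>L 'f::banach_lattice"
  assumes "DP_star_property TYPE('f)"
  shows "disjoint_weak_star_Dunford_Pettis T \<longleftrightarrow>
    (\<forall>A. sigma_uaw_compact A \<longrightarrow> limited_set (blinfun_apply T ` A))"
proof (intro iffI allI impI)
  fix A :: "'e set"
  assume T: "disjoint_weak_star_Dunford_Pettis T" and A: "sigma_uaw_compact A"
  show "limited_set (blinfun_apply T ` A)"
    unfolding limited_set_def
  proof (intro conjI allI impI)
    show "bounded (T ` A)"
      using A by (intro bounded_linear_image blinfun.bounded_linear_right)
        (simp add: sigma_uaw_compact_def)
    fix f :: "nat \<Rightarrow> 'f \<Rightarrow>\<^sub>L real"
    assume f: "weak_star_null f"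
    show "uniform_limit (T ` A) (\<lambda>n. blinfun_apply (f n)) (\<lambda>_. 0) sequentially"
    proof (rule ccontr)
      assume "\<not> ?thesis"
      then obtain e where e: "0 < e" "\<And>N. \<exists>n\<ge>N. \<exists>a\<in>A. e \<le> \<bar>f n (T a)\<bar>"
        unfolding uniform_limit_sequentially_iff by (auto simp: not_less dist_real_def)
      \<comment> \<open>Failure of uniform convergence gives bad pairs of an index and a point of
        \<open>A\<close>; they are chosen with strictly increasing indices so that the functionals
        form a subsequence.\<close>
      have "\<exists>na. \<forall>k. (snd (na k) \<in> A \<and> e \<le> \<bar>f (fst (na k)) (T (snd (na k)))\<bar>) \<and>
        fst (na k) < fst (na (Suc k))"
      proof (rule dependent_nat_choice)
        show "\<exists>na. snd na \<in> A \<and> e \<le> \<bar>f (fst na) (T (snd na))\<bar>"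
          using e(2)[of 0] by auto
        fix na :: "nat \<times> 'e" and k :: nat
        show "\<exists>nb. (snd nb \<in> A \<and> e \<le> \<bar>f (fst nb) (T (snd nb))\<bar>) \<and> fst na < fst nb"
          using e(2)[of "Suc (fst na)"] by (auto simp: Suc_le_eq)
      qed
      then obtain na where na: "\<And>k. snd (na k) \<in> A"
        "\<And>k. e \<le> \<bar>f (fst (na k)) (T (snd (na k)))\<bar>" "\<And>k. fst (na k) < fst (na (Suc k))"
        by blast
      define r where "r = fst \<circ> na"
      define a where "a = snd \<circ> na"
      have r: "strict_mono r" using na(3) by (simp add: r_def strict_mono_Suc_iff)
      have "\<forall>k. a k \<in> A" using na(1) by (simp add: a_def)
      then obtain l s where s: "strict_mono s" "uaw_tendsto (a \<circ> s) l"
        using A unfolding sigma_uaw_compact_def by blast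
      define g where "g = f \<circ> (r \<circ> s)"
      have g: "weak_star_null g"
        unfolding g_def using r s(1) by (intro weak_star_null_subseq[OF f] strict_mono_o)
      \<comment> \<open>Translation by the uaw-limit gives a bounded uaw-null sequence; the constant
        term \<open>T l\<close> that is split off is handled by weak* convergence alone.\<close>
      define y where "y n = a (s n) - l" for n
      have "bounded A" using A by (simp add: sigma_uaw_compact_def)
      then have "bounded ((\<lambda>x. x - l) ` A)" by (rule bounded_translation_minus)
      then have "bounded (range y)"
        by (rule bounded_subset) (use \<open>\<forall>k. a k \<in> A\<close> in \<open>auto simp: y_def\<close>)
      moreover have "uaw_tendsto y 0"
        using s(2) by (simp add: uaw_tendsto_def y_def)
      ultimately have "(\<lambda>n. g n (T (y n))) \<longlonglongrightarrow> 0"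
        using disjoint_weak_star_DP_uaw_null[OF assms T g] by blast
      moreover have "(\<lambda>n. g n (T l)) \<longlonglongrightarrow> 0"
        using g by (simp add: weak_star_null_def)
      ultimately have "(\<lambda>n. g n (T (y n)) + g n (T l)) \<longlonglongrightarrow> 0 + 0"
        by (rule tendsto_add)
      then have "(\<lambda>n. g n (T (a (s n)))) \<longlonglongrightarrow> 0"
        by (simp add: y_def flip: blinfun.add_right)
      then have "\<forall>\<^sub>F n in sequentially. \<bar>g n (T (a (s n)))\<bar> < e"
        using e(1) by (auto simp: tendsto_iff)
      then obtain n where "\<bar>g n (T (a (s n)))\<bar> < e" by (auto simp: eventually_sequentially)
      then show False using na(2)[of "s n"] by (simp add: g_def r_def a_def)
    qed
  qed
next
  assume lim: "\<forall>A. sigma_uaw_compact A \<longrightarrow> limited_set (blinfun_apply T ` A)"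
  show "disjoint_weak_star_Dunford_Pettis T"
    unfolding disjoint_weak_star_Dunford_Pettis_def
  proof (intro allI impI)
    fix x :: "nat \<Rightarrow> 'e" and f :: "nat \<Rightarrow> 'f \<Rightarrow>\<^sub>L real"
    assume "bounded (range x)" "disjoint_sequence x" and f: "weak_star_null f"
    \<comment> \<open>With \<open>A = range x\<close>, uniform convergence on the image of the whole
      range includes convergence along the diagonal \<open>f n (T (x n))\<close>.\<close>
    then have "limited_set (T ` range x)"
      using lim disjoint_sequence_range_sigma_uaw_compact by blast
    then have unif: "uniform_limit (T ` range x) (\<lambda>n. blinfun_apply (f n)) (\<lambda>_. 0) sequentially"
      using f by (simp add: limited_set_def)
    show "(\<lambda>n. f n (T (x n))) \<longlonglongrightarrow> 0"
    proof (rule tendstoI)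
      fix e :: real assume "0 < e"
      from uniform_limitD[OF unif this]
      show "\<forall>\<^sub>F n in sequentially. dist (f n (T (x n))) 0 < e"
        by eventually_elim auto
    qed
  qed
qed

end
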